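(* Let $D$ be a parallelogram in the $xy$ plane. Then there is a unique ellipse $E_I$ of minimal eccentricity inscribed in $D$; that is, there is exactly one ellipse inscribed in $D$ whose eccentricity is less than or equal to that of every ellipse inscribed in $D$.
   Context: Parallelograms are nondegenerate. An ellipse (circles are allowed) is inscribed in a parallelogram $D$ if it lies in $D$ and is tangent to each of the four sides of $D$. If $a\ge b>0$ are the lengths of the semi-major and semi-minor axes of an ellipse, its eccentricity is $\sqrt{1-b^2/a^2}$ (so a circle has eccentricity $0$). *)

theory Defs
  imports "HOL-Analysis.Analysis"
begin

definition ellipse_semiaxes :: "(real^2) set \<Rightarrow> real \<Rightarrow> real \<Rightarrow> bool" where
  "ellipse_semiaxes E a b \<longleftrightarrow> 0 < b \<and> b \<le> a \<and>
     (\<exists>c u v. norm u = 1 \<and> norm v = 1 \<and> orthogonal u v \<and>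
        E = {c + x *\<^sub>R u + y *\<^sub>R v | x y. x\<^sup>2 / a\<^sup>2 + y\<^sup>2 / b\<^sup>2 = 1})"

text \<open>An ellipse is the curve, not the filled region.\<close>

definition is_ellipse :: "(real^2) set \<Rightarrow> bool" where
  "is_ellipse E \<longleftrightarrow> (\<exists>a b. ellipse_semiaxes E a b)"

text \<open>Well-defined on ellipses: see \<open>eccentricity_eq\<close> below.\<close>

definition eccentricity :: "(real^2) set \<Rightarrow> real" where
  "eccentricity E = (THE e. \<exists>a b. ellipse_semiaxes E a b \<and> e = sqrt (1 - b\<^sup>2 / a\<^sup>2))"

text \<open>The direction is the velocity at \<open>p\<close> of a path running inside the curve \<open>E\<close>.\<close>

definition tangent_line_at :: "(real^2) set \<Rightarrow> real^2 \<Rightarrow> (real^2) set \<Rightarrow> bool" where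
  "tangent_line_at E p L \<longleftrightarrow>
     (\<exists>\<gamma> w. range \<gamma> \<subseteq> E \<and> \<gamma> 0 = p \<and> (\<gamma> has_vector_derivative w) (at (0::real)) \<and> w \<noteq> 0 \<and>
            L = {p + t *\<^sub>R w | t. True})"

text \<open>The point of contact is required to lie on the segment itself, not just on its line.\<close>

definition tangent_to_segment :: "(real^2) set \<Rightarrow> real^2 \<Rightarrow> real^2 \<Rightarrow> bool" where
  "tangent_to_segment E P Q \<longleftrightarrow>
     (\<exists>p \<in> E \<inter> closed_segment P Q. tangent_line_at E p (affine hull {P, Q}))"

text \<open>\<open>A\<close>, \<open>B\<close>, \<open>C\<close>, \<open>D\<close> are the vertices in cyclic order.\<close>

definition parallelogram :: "real^2 \<Rightarrow> real^2 \<Rightarrow> real^2 \<Rightarrow> real^2 \<Rightarrow> bool" where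
  "parallelogram A B C D \<longleftrightarrow> B - A = C - D \<and> \<not> collinear {A, B, C}"

definition inscribed :: "(real^2) set \<Rightarrow> real^2 \<Rightarrow> real^2 \<Rightarrow> real^2 \<Rightarrow> real^2 \<Rightarrow> bool" where
  "inscribed E A B C D \<longleftrightarrow> is_ellipse E \<and> E \<subseteq> convex hull {A, B, C, D} \<and>
     tangent_to_segment E A B \<and> tangent_to_segment E B C \<and>
     tangent_to_segment E C D \<and> tangent_to_segment E D A"

lemma norm_frame:
  fixes u v :: "real^2"
  assumes "norm u = 1" "norm v = 1" "orthogonal u v"
  shows "(norm (x *\<^sub>R u + y *\<^sub>R v))\<^sup>2 = x\<^sup>2 + y\<^sup>2"
proof -
  have "u \<bullet> u = 1" "v \<bullet> v = 1" "u \<bullet> v = 0" "v \<bullet> u = 0"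
    using assms by (auto simp: norm_eq_1 orthogonal_def inner_commute)
  then show ?thesis
    unfolding power2_norm_eq_inner
    by (simp add: inner_add_left inner_add_right power2_eq_square)
qed

lemma semiaxes_bounds:
  fixes x y a b :: real
  assumes "0 < b" "b \<le> a" "x\<^sup>2 / a\<^sup>2 + y\<^sup>2 / b\<^sup>2 = 1"
  shows "b\<^sup>2 \<le> x\<^sup>2 + y\<^sup>2" "x\<^sup>2 + y\<^sup>2 \<le> a\<^sup>2"
proof -
  define X where "X = x\<^sup>2 / a\<^sup>2"
  define Y where "Y = y\<^sup>2 / b\<^sup>2"
  have XY: "X + Y = 1" "0 \<le> X" "0 \<le> Y"
    using assms by (auto simp: X_def Y_def)
  have x: "x\<^sup>2 = X * a\<^sup>2" and y: "y\<^sup>2 = Y * b\<^sup>2"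
    using assms by (auto simp: X_def Y_def)
  have ba: "b\<^sup>2 \<le> a\<^sup>2"
    using assms by (simp add: power_mono)
  have 1: "X * b\<^sup>2 \<le> X * a\<^sup>2" and 2: "Y * b\<^sup>2 \<le> Y * a\<^sup>2"
    using ba XY by (auto intro: mult_left_mono)
  have 3: "X * b\<^sup>2 + Y * b\<^sup>2 = b\<^sup>2" "X * a\<^sup>2 + Y * a\<^sup>2 = a\<^sup>2"
    using XY by (simp_all flip: distrib_right)
  show "b\<^sup>2 \<le> x\<^sup>2 + y\<^sup>2" "x\<^sup>2 + y\<^sup>2 \<le> a\<^sup>2"
    using 1 2 3 x y by linarith+
qed

lemma ellipse_semiaxesE:
  assumes "ellipse_semiaxes E a b"
  obtains c u v where "0 < b" "b \<le> a" "norm u = 1" "norm v = 1"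
    "c + a *\<^sub>R u \<in> E" "c - a *\<^sub>R u \<in> E" "c + b *\<^sub>R v \<in> E"
    "\<And>p. p \<in> E \<Longrightarrow> b\<^sup>2 \<le> (norm (p - c))\<^sup>2 \<and> (norm (p - c))\<^sup>2 \<le> a\<^sup>2"
proof -
  from assms obtain c u v where *: "0 < b" "b \<le> a" "norm u = 1" "norm v = 1" "orthogonal u v"
    and E: "E = {c + x *\<^sub>R u + y *\<^sub>R v | x y. x\<^sup>2 / a\<^sup>2 + y\<^sup>2 / b\<^sup>2 = 1}"
    unfolding ellipse_semiaxes_def by blast
  have mem: "c + x *\<^sub>R u + y *\<^sub>R v \<in> E" if "x\<^sup>2 / a\<^sup>2 + y\<^sup>2 / b\<^sup>2 = 1" for x y
    using that unfolding E by blast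
  have bd: "b\<^sup>2 \<le> (norm (p - c))\<^sup>2 \<and> (norm (p - c))\<^sup>2 \<le> a\<^sup>2" if "p \<in> E" for p
  proof -
    from that obtain x y where p: "p = c + x *\<^sub>R u + y *\<^sub>R v" and 1: "x\<^sup>2 / a\<^sup>2 + y\<^sup>2 / b\<^sup>2 = 1"
      unfolding E by blast
    have "p - c = x *\<^sub>R u + y *\<^sub>R v"
      by (simp add: p)
    then show ?thesis
      using norm_frame[OF *(3-5), of x y] semiaxes_bounds[OF *(1,2) 1] by simp
  qed
  show thesis
    using that[OF *(1-4) _ _ _ bd] mem[of a 0] mem[of "-a" 0] mem[of 0 b] *(1,2) by simp
qed

lemma ellipse_semiaxes_unique:
  assumes "ellipse_semiaxes E a b" "ellipse_semiaxes E a' b'"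
  shows "a = a' \<and> b = b'"
proof -
  have major: "s\<^sup>2 + (norm (c - c'))\<^sup>2 \<le> s'\<^sup>2"
    if "norm u = 1" "c + s *\<^sub>R u \<in> E" "c - s *\<^sub>R u \<in> E"
      "\<And>p. p \<in> E \<Longrightarrow> (norm (p - c'))\<^sup>2 \<le> s'\<^sup>2" for c c' u :: "real^2" and s s' :: real
  proof -
    have "u \<bullet> u = 1"
      using that(1) by (simp add: norm_eq_1)
    then have "(norm (c + s *\<^sub>R u - c'))\<^sup>2 + (norm (c - s *\<^sub>R u - c'))\<^sup>2
        = 2 * (s\<^sup>2 + (norm (c - c'))\<^sup>2)"
      unfolding power2_norm_eq_inner
      by (simp add: inner_add_left inner_add_right inner_diff_left
          inner_diff_right power2_eq_square inner_commute algebra_simps)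
    then show ?thesis
      using add_mono[OF that(4)[OF that(2)] that(4)[OF that(3)]] by simp
  qed
  obtain c u v where 1: "0 < b" "b \<le> a" "norm u = 1" "norm v = 1"
    "c + a *\<^sub>R u \<in> E" "c - a *\<^sub>R u \<in> E" "c + b *\<^sub>R v \<in> E"
    "\<And>p. p \<in> E \<Longrightarrow> b\<^sup>2 \<le> (norm (p - c))\<^sup>2 \<and> (norm (p - c))\<^sup>2 \<le> a\<^sup>2"
    using assms(1) by (rule ellipse_semiaxesE) blast
  obtain c' u' v' where 2: "0 < b'" "b' \<le> a'" "norm u' = 1" "norm v' = 1"
    "c' + a' *\<^sub>R u' \<in> E" "c' - a' *\<^sub>R u' \<in> E" "c' + b' *\<^sub>R v' \<in> E"
    "\<And>p. p \<in> E \<Longrightarrow> b'\<^sup>2 \<le> (norm (p - c'))\<^sup>2 \<and> (norm (p - c'))\<^sup>2 \<le> a'\<^sup>2"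
    using assms(2) by (rule ellipse_semiaxesE) blast
  have A: "a\<^sup>2 + (norm (c - c'))\<^sup>2 \<le> a'\<^sup>2"
    using major[OF 1(3,5,6)] 2(8) by blast
  have B: "a'\<^sup>2 + (norm (c' - c))\<^sup>2 \<le> a\<^sup>2"
    using major[OF 2(3,5,6)] 1(8) by blast
  have aa: "a\<^sup>2 = a'\<^sup>2" and "(norm (c - c'))\<^sup>2 = 0"
    using A B zero_le_power2[of "norm (c - c')"] zero_le_power2[of "norm (c' - c)"]
    by linarith+
  then have c: "c' = c"
    by simp
  have "b'\<^sup>2 \<le> b\<^sup>2" "b\<^sup>2 \<le> b'\<^sup>2"
    using 2(8)[OF 1(7)] 1(8)[OF 2(7)] 1(4) 2(4) by (simp_all add: c)
  then have "b\<^sup>2 = b'\<^sup>2"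
    by simp
  then show ?thesis
    using aa 1(1,2) 2(1,2) by (simp add: power2_eq_iff_nonneg)
qed

lemma eccentricity_eq:
  assumes "ellipse_semiaxes E a b"
  shows "eccentricity E = sqrt (1 - b\<^sup>2 / a\<^sup>2)"
  unfolding eccentricity_def
  by (rule the_equality) (use assms ellipse_semiaxes_unique in blast)+

end

theory Submission
  imports Defs
begin

text \<open>
  Let \<open>c\<close> be the centre of the parallelogram and \<open>2e\<close>, \<open>2f\<close> its edge vectors. In the affine
  coordinates \<open>c + s e + t f\<close> the parallelogram is the square \<open>\<bar>s\<bar>, \<bar>t\<bar> \<le> 1\<close>, and an ellipse
  is inscribed in it iff both coordinates have extreme values \<open>-1\<close> and \<open>1\<close> along the ellipse.
  This leaves the one-parameter family \<open>s\<^sup>2 + t\<^sup>2 - 2rst = 1 - r\<^sup>2\<close> with \<open>-1 < r < 1\<close>. Its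
  semiaxes satisfy \<open>a\<^sup>2 + b\<^sup>2 = p + 2rq\<close> and \<open>a\<^sup>2 b\<^sup>2 = (1 - r\<^sup>2) (cross2 e f)\<^sup>2\<close>, where
  \<open>p = e \<bullet> e + f \<bullet> f\<close> and \<open>q = e \<bullet> f\<close>. The eccentricity is a decreasing function of
  \<open>ab / (a\<^sup>2 + b\<^sup>2)\<close>, and the identity
  \<open>(p + 2rq)\<^sup>2 - (1 - r\<^sup>2) (p\<^sup>2 - 4q\<^sup>2) = (rp + 2q)\<^sup>2\<close> shows that the latter is maximal exactly
  at \<open>r = -2q/p\<close>.
\<close>

section \<open>Plane cross product and oblique coordinates\<close>

definition cross2 :: "real^2 \<Rightarrow> real^2 \<Rightarrow> real" where
  "cross2 x y = x $ 1 * y $ 2 - x $ 2 * y $ 1"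

lemma cross2_simps [simp]:
  "cross2 x x = 0"
  "cross2 (x + y) z = cross2 x z + cross2 y z"
  "cross2 x (y + z) = cross2 x y + cross2 x z"
  "cross2 (x - y) z = cross2 x z - cross2 y z"
  "cross2 x (y - z) = cross2 x y - cross2 x z"
  "cross2 (a *\<^sub>R x) y = a * cross2 x y"
  "cross2 x (a *\<^sub>R y) = a * cross2 x y"
  "cross2 (- x) y = - cross2 x y"
  "cross2 x (- y) = - cross2 x y"
  by (simp_all add: cross2_def algebra_simps)

lemma cross2_commute: "cross2 y x = - cross2 x y"
  by (simp add: cross2_def)

lemma inner_real2: "(x::real^2) \<bullet> y = x $ 1 * y $ 1 + x $ 2 * y $ 2"
  by (simp add: inner_vec_def sum_2)

lemma lagrange_identity2: "(x \<bullet> x) * (y \<bullet> y) = (x \<bullet> y)\<^sup>2 + (cross2 x y)\<^sup>2"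
  unfolding inner_real2 cross2_def by algebra

text \<open>By the Lagrange identity, a vanishing cross product means equality in
  Cauchy-Schwarz.\<close>

lemma collinear_if_cross2_eq_0:
  assumes "cross2 x y = 0"
  shows "collinear {0, x, y}"
proof -
  have "(x \<bullet> y)\<^sup>2 = (norm x * norm y)\<^sup>2"
    using lagrange_identity2[of x y] assms
    by (simp add: power_mult_distrib power2_norm_eq_inner)
  then have "\<bar>x \<bullet> y\<bar> = norm x * norm y"
    by (metis abs_ge_zero abs_norm_cancel abs_mult power2_eq_iff_nonneg power2_abs)
  then show ?thesis
    by (simp add: norm_cauchy_schwarz_equal)
qed

text \<open>Cramer's rule in the basis \<open>e\<close>, \<open>f\<close>.\<close>

lemma cross2_expansion:
  assumes "cross2 e f \<noteq> 0"
  shows "x = (cross2 x f / cross2 e f) *\<^sub>R e + (cross2 e x / cross2 e f) *\<^sub>R f"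
proof -
  have "cross2 e f *\<^sub>R x = cross2 x f *\<^sub>R e + cross2 e x *\<^sub>R f"
    unfolding vec_eq_iff forall_2 cross2_def by (simp add: algebra_simps)
  then have "x = (1 / cross2 e f) *\<^sub>R (cross2 x f *\<^sub>R e + cross2 e x *\<^sub>R f)"
    using assms by (metis divide_self_if scaleR_one scaleR_scaleR times_divide_eq_left mult_1)
  then show ?thesis
    by (simp add: scaleR_add_right)
qed

lemma cross2_coordinates:
  assumes "cross2 e f \<noteq> 0" "s *\<^sub>R e + t *\<^sub>R f = s' *\<^sub>R e + t' *\<^sub>R f"
  shows "s = s'" "t = t'"
proof -
  have "cross2 (s *\<^sub>R e + t *\<^sub>R f) f = cross2 (s' *\<^sub>R e + t' *\<^sub>R f) f"
    "cross2 e (s *\<^sub>R e + t *\<^sub>R f) = cross2 e (s' *\<^sub>R e + t' *\<^sub>R f)"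
    using assms(2) by simp_all
  then show "s = s'" "t = t'"
    using assms(1) by simp_all
qed


section \<open>Ellipses with conjugate radii\<close>

text \<open>An affine image of the unit circle; independent \<open>m\<close>, \<open>n\<close> are
  conjugate radii of it. They may be oblique, so that they can be adapted to the parallelogram
  instead of the principal axes.\<close>

definition conjugate_ellipse :: "real^2 \<Rightarrow> real^2 \<Rightarrow> real^2 \<Rightarrow> (real^2) set" where
  "conjugate_ellipse c m n = {c + x *\<^sub>R m + y *\<^sub>R n | x y. x\<^sup>2 + y\<^sup>2 = 1}"

lemma conjugate_ellipse_scaled_axes:
  fixes a b :: real
  assumes "0 < a" "0 < b"
  shows "{c + x *\<^sub>R u + y *\<^sub>R v | x y. x\<^sup>2 / a\<^sup>2 + y\<^sup>2 / b\<^sup>2 = 1}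
    = conjugate_ellipse c (a *\<^sub>R u) (b *\<^sub>R v)" (is "?L = ?R")
proof
  show "?L \<subseteq> ?R"
  proof
    fix z assume "z \<in> ?L"
    then obtain x y where z: "z = c + x *\<^sub>R u + y *\<^sub>R v" "x\<^sup>2 / a\<^sup>2 + y\<^sup>2 / b\<^sup>2 = 1"
      by blast
    have "z = c + (x / a) *\<^sub>R a *\<^sub>R u + (y / b) *\<^sub>R b *\<^sub>R v" "(x / a)\<^sup>2 + (y / b)\<^sup>2 = 1"
      using z assms by (simp_all add: power_divide)
    then show "z \<in> ?R"
      unfolding conjugate_ellipse_def by blast
  qed
  show "?R \<subseteq> ?L"
  proof
    fix z assume "z \<in> ?R"
    then obtain x y where z: "z = c + x *\<^sub>R a *\<^sub>R u + y *\<^sub>R b *\<^sub>R v" "x\<^sup>2 + y\<^sup>2 = 1"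
      unfolding conjugate_ellipse_def by blast
    have "z = c + (x * a) *\<^sub>R u + (y * b) *\<^sub>R v" "(x * a)\<^sup>2 / a\<^sup>2 + (y * b)\<^sup>2 / b\<^sup>2 = 1"
      using z assms by (simp_all add: power_mult_distrib)
    then show "z \<in> ?L"
      by blast
  qed
qed

lemma conjugate_ellipse_commute: "conjugate_ellipse c m n = conjugate_ellipse c n m"
proof -
  have "conjugate_ellipse c m n \<subseteq> conjugate_ellipse c n m" for m n
  proof
    fix z assume "z \<in> conjugate_ellipse c m n"
    then obtain x y where "z = c + x *\<^sub>R m + y *\<^sub>R n" "x\<^sup>2 + y\<^sup>2 = 1"
      unfolding conjugate_ellipse_def by blast
    then have "z = c + y *\<^sub>R n + x *\<^sub>R m" "y\<^sup>2 + x\<^sup>2 = 1"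
      by simp_all
    then show "z \<in> conjugate_ellipse c n m"
      unfolding conjugate_ellipse_def by blast
  qed
  then show ?thesis
    by blast
qed

text \<open>With \<open>k\<close>, \<open>l\<close> the cosine and sine of an angle, passing to the
  new radii amounts to rotating the parameter \<open>(x, y)\<close> on the unit circle.\<close>

lemma conjugate_ellipse_rotate_subset:
  fixes k l :: real
  assumes "k\<^sup>2 + l\<^sup>2 = 1"
  shows "conjugate_ellipse c (k *\<^sub>R m + l *\<^sub>R n) (k *\<^sub>R n - l *\<^sub>R m) \<subseteq> conjugate_ellipse c m n"
proof
  fix z assume "z \<in> conjugate_ellipse c (k *\<^sub>R m + l *\<^sub>R n) (k *\<^sub>R n - l *\<^sub>R m)"
  then obtain x y where "z = c + x *\<^sub>R (k *\<^sub>R m + l *\<^sub>R n) + y *\<^sub>R (k *\<^sub>R n - l *\<^sub>R m)"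
    and xy: "x\<^sup>2 + y\<^sup>2 = 1"
    unfolding conjugate_ellipse_def by blast
  then have "z = c + (x * k - y * l) *\<^sub>R m + (x * l + y * k) *\<^sub>R n"
    by (simp add: algebra_simps)
  moreover have "(x * k - y * l)\<^sup>2 + (x * l + y * k)\<^sup>2 = 1"
    using assms xy by algebra
  ultimately show "z \<in> conjugate_ellipse c m n"
    unfolding conjugate_ellipse_def by blast
qed

lemma conjugate_ellipse_rotate:
  fixes k l :: real
  assumes "k\<^sup>2 + l\<^sup>2 = 1"
  shows "conjugate_ellipse c (k *\<^sub>R m + l *\<^sub>R n) (k *\<^sub>R n - l *\<^sub>R m) = conjugate_ellipse c m n"
    (is "conjugate_ellipse c ?m ?n = _")
proof
  \<comment> \<open>Rotating by the inverse angle, with coefficients \<open>k\<close> and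
    \<open>- l\<close>, recovers \<open>m\<close> and \<open>n\<close>; the known inclusion then
    yields its converse.\<close>
  have "k *\<^sub>R ?m + (- l) *\<^sub>R ?n = (k\<^sup>2 + l\<^sup>2) *\<^sub>R m" "k *\<^sub>R ?n - (- l) *\<^sub>R ?m = (k\<^sup>2 + l\<^sup>2) *\<^sub>R n"
    by (simp_all add: algebra_simps power2_eq_square)
  then show "conjugate_ellipse c m n \<subseteq> conjugate_ellipse c ?m ?n"
    using conjugate_ellipse_rotate_subset[of k "- l" c ?m ?n] assms by simp
qed (rule conjugate_ellipse_rotate_subset[OF assms])

text \<open>For \<open>B \<noteq> 0\<close> the zero comes from
  \<open>tan (2 * t) = - A / B\<close>. It serves to make two conjugate radii orthogonal.\<close>

lemma exists_principal_angle:
  fixes A B :: real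
  obtains t where "A * cos (2 * t) + B * sin (2 * t) = 0"
proof (cases "B = 0")
  case True
  then show ?thesis
    using that[of "pi / 4"] by simp
next
  case False
  define x where "x = arctan (- A / B)"
  have tan: "tan x = - A / B" and "cos x \<noteq> 0"
    unfolding x_def by (rule tan_arctan, rule cos_arctan_not_zero)
  from this(2) have "sin x = tan x * cos x"
    by (simp add: tan_def)
  then have "sin x = - A / B * cos x"
    unfolding tan .
  then show ?thesis
    using that[of "x / 2"] False by simp
qed

text \<open>These are the theorems of Apollonius: rotating the parameter preserves the sum of the
  squared lengths of conjugate radii and the area they span. Rotated until they are orthogonal, the
  radii become the semiaxes.\<close>

lemma conjugate_ellipse_semiaxes:
  assumes "cross2 m n \<noteq> 0"
  obtains a b where "ellipse_semiaxes (conjugate_ellipse c m n) a b"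
    "a\<^sup>2 + b\<^sup>2 = m \<bullet> m + n \<bullet> n" "a * b = \<bar>cross2 m n\<bar>"
proof -
  \<comment> \<open>By the double-angle formulas the left side is the inner product of the radii
    rotated by \<open>t\<close>.\<close>
  obtain t where t: "(m \<bullet> n) * cos (2 * t) + ((n \<bullet> n - m \<bullet> m) / 2) * sin (2 * t) = 0"
    by (rule exists_principal_angle)
  define k where "k = cos t"
  define l where "l = sin t"
  have kl: "k\<^sup>2 + l\<^sup>2 = 1"
    by (simp add: k_def l_def)
  define m' where "m' = k *\<^sub>R m + l *\<^sub>R n"
  define n' where "n' = k *\<^sub>R n - l *\<^sub>R m"
  have orth: "m' \<bullet> n' = 0"
  proof -
    have "m' \<bullet> n' = (m \<bullet> n) * (k\<^sup>2 - l\<^sup>2) + ((n \<bullet> n - m \<bullet> m) / 2) * (2 * l * k)"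
      unfolding m'_def n'_def
      by (simp add: inner_add_left inner_diff_right inner_commute[of n m] field_simps power2_eq_square)
    then show ?thesis
      using t by (simp add: cos_double sin_double k_def l_def)
  qed
  have sum: "m' \<bullet> m' + n' \<bullet> n' = m \<bullet> m + n \<bullet> n"
  proof -
    have "m' \<bullet> m' + n' \<bullet> n' = (k\<^sup>2 + l\<^sup>2) * (m \<bullet> m + n \<bullet> n)"
      unfolding m'_def n'_def
      by (simp add: inner_add_left inner_add_right inner_diff_left inner_diff_right
          inner_commute algebra_simps power2_eq_square)
    then show ?thesis
      using kl by simp
  qed
  have cross: "cross2 m' n' = cross2 m n"
  proof -
    have "cross2 m' n' = (k\<^sup>2 + l\<^sup>2) * cross2 m n"
      unfolding m'_def n'_def using cross2_commute[of n m]
      by (simp add: algebra_simps power2_eq_square)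
    then show ?thesis
      using kl by simp
  qed
  have prod: "norm m' * norm n' = \<bar>cross2 m n\<bar>"
  proof -
    have "(norm m' * norm n')\<^sup>2 = \<bar>cross2 m n\<bar>\<^sup>2"
      using lagrange_identity2[of m' n'] orth cross
      by (simp add: power_mult_distrib power2_norm_eq_inner)
    then show ?thesis
      by (subst (asm) power2_eq_iff_nonneg) auto
  qed
  have nz: "m' \<noteq> 0" "n' \<noteq> 0"
    using prod assms by auto
  have E: "conjugate_ellipse c m n = conjugate_ellipse c m' n'"
    unfolding m'_def n'_def by (simp add: conjugate_ellipse_rotate kl)
  \<comment> \<open>\<open>ellipse_semiaxes\<close> wants the larger semiaxis first, so this is
    stated for any orthogonal pair and used in the order that the norms dictate.\<close>
  have axes: "ellipse_semiaxes (conjugate_ellipse c x y) (norm x) (norm y)"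
    if "x \<bullet> y = 0" "x \<noteq> 0" "y \<noteq> 0" "norm y \<le> norm x" for x y :: "real^2"
  proof -
    have "conjugate_ellipse c x y
        = {c + r *\<^sub>R sgn x + s *\<^sub>R sgn y | r s. r\<^sup>2 / (norm x)\<^sup>2 + s\<^sup>2 / (norm y)\<^sup>2 = 1}"
      using that conjugate_ellipse_scaled_axes[of "norm x" "norm y" c "sgn x" "sgn y"]
      by (simp add: sgn_div_norm)
    moreover have "norm (sgn x) = 1" "norm (sgn y) = 1" "orthogonal (sgn x) (sgn y)"
      using that by (simp_all add: norm_sgn orthogonal_def sgn_div_norm)
    ultimately show ?thesis
      unfolding ellipse_semiaxes_def using that by auto
  qed
  show thesis
  proof (cases "norm n' \<le> norm m'")
    case True
    show ?thesis
    proof (rule that)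
      show "ellipse_semiaxes (conjugate_ellipse c m n) (norm m') (norm n')"
        unfolding E by (rule axes) (use orth nz True in auto)
    qed (use sum prod in \<open>simp_all add: power2_norm_eq_inner\<close>)
  next
    case False
    show ?thesis
    proof (rule that)
      show "ellipse_semiaxes (conjugate_ellipse c m n) (norm n') (norm m')"
        unfolding E conjugate_ellipse_commute[of c m' n']
        by (rule axes) (use orth nz False in \<open>auto simp: inner_commute\<close>)
    qed (use sum prod in \<open>simp_all add: power2_norm_eq_inner add.commute mult.commute\<close>)
  qed
qed


section \<open>Comparing eccentricities\<close>

text \<open>On \<open>0 < k \<le> 1\<close>, where \<open>k = b / a\<close>, the eccentricity
  decreases in \<open>k\<close> while \<open>k / (1 + k^2)\<close> increases. The criterion involves
  only the product and the sum of squares of the semiaxes, which are known from any pair of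
  conjugate radii.\<close>

lemma eccentricity_le_iff:
  assumes E: "ellipse_semiaxes E a b" and E': "ellipse_semiaxes E' a' b'"
  shows "eccentricity E' \<le> eccentricity E
    \<longleftrightarrow> (a * b / (a\<^sup>2 + b\<^sup>2))\<^sup>2 \<le> (a' * b' / (a'\<^sup>2 + b'\<^sup>2))\<^sup>2"
proof -
  have pos: "0 < b" "b \<le> a" "0 < b'" "b' \<le> a'" "0 < a" "0 < a'"
    using E E' unfolding ellipse_semiaxes_def by auto
  define k where "k = b / a"
  define k' where "k' = b' / a'"
  have k: "0 < k" "k \<le> 1" "0 < k'" "k' \<le> 1"
    using pos by (auto simp: k_def k'_def)
  have ratio: "x * y / (x\<^sup>2 + y\<^sup>2) = (y / x) / (1 + (y / x)\<^sup>2)" if "0 < x" for x y :: real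
  proof -
    have "x\<^sup>2 + y\<^sup>2 \<noteq> 0"
      using that by (simp add: sum_power2_eq_zero_iff)
    then show ?thesis
      using that by (simp add: divide_simps power2_eq_square)
  qed
  have "eccentricity E' \<le> eccentricity E \<longleftrightarrow> k\<^sup>2 \<le> k'\<^sup>2"
    by (simp add: eccentricity_eq[OF E] eccentricity_eq[OF E'] k_def k'_def power_divide)
  also have "\<dots> \<longleftrightarrow> k \<le> k'"
    using k by (simp add: power_mono_iff)
  also have "\<dots> \<longleftrightarrow> k / (1 + k\<^sup>2) \<le> k' / (1 + k'\<^sup>2)"
  proof -
    have "k / (1 + k\<^sup>2) \<le> k' / (1 + k'\<^sup>2) \<longleftrightarrow> k * (1 + k'\<^sup>2) \<le> k' * (1 + k\<^sup>2)"
      by (simp add: divide_simps add_pos_nonneg mult.commute)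
    \<comment> \<open>The difference of the two sides factors; its second factor is positive unless
      \<open>k = k' = 1\<close>.\<close>
    also have "\<dots> \<longleftrightarrow> 0 \<le> (k' - k) * (1 - k * k')"
      by (simp add: algebra_simps power2_eq_square)
    also have "\<dots> \<longleftrightarrow> k \<le> k'"
    proof (cases "k * k' = 1")
      case True
      then have "k = 1 \<and> k' = 1"
        using k mult_left_le[of k' k] mult_left_le[of k k'] by (auto simp: mult.commute)
      then show ?thesis
        by simp
    next
      case False
      then have "k * k' < 1"
        using k mult_le_one[of k k'] by simp
      then show ?thesis
        by (auto simp: zero_le_mult_iff)
    qed
    finally show ?thesis ..
  qed
  also have "\<dots> \<longleftrightarrow> (k / (1 + k\<^sup>2))\<^sup>2 \<le> (k' / (1 + k'\<^sup>2))\<^sup>2"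
    using k by (simp add: power_mono_iff add_nonneg_nonneg)
  finally show ?thesis
    using ratio[OF pos(5), of b] ratio[OF pos(6), of b'] by (simp add: k_def k'_def)
qed


section \<open>The inscribed ellipses\<close>

text \<open>For \<open>r = cos y\<close> this is the curve \<open>s = cos x\<close>,
  \<open>t = cos (x - y)\<close>. It meets the sides \<open>t = 1\<close> and \<open>s = 1\<close>
  at \<open>(r, 1)\<close> and \<open>(1, r)\<close>; for \<open>r = 1\<close> or
  \<open>r = -1\<close> it degenerates to the line through a diagonal.\<close>

definition inscribed_family :: "real^2 \<Rightarrow> real^2 \<Rightarrow> real^2 \<Rightarrow> real \<Rightarrow> (real^2) set" where
  "inscribed_family c e f r = {c + s *\<^sub>R e + t *\<^sub>R f | s t. s\<^sup>2 + t\<^sup>2 - 2 * r * s * t = 1 - r\<^sup>2}"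

text \<open>This symmetry and \<open>inscribed_family_minus\<close> let one tangency computation
  serve all four sides.\<close>

lemma inscribed_family_swap: "inscribed_family c f e r = inscribed_family c e f r"
proof -
  have "inscribed_family c e f r \<subseteq> inscribed_family c f e r" for e f
  proof
    fix z assume "z \<in> inscribed_family c e f r"
    then obtain s t where "z = c + s *\<^sub>R e + t *\<^sub>R f" "s\<^sup>2 + t\<^sup>2 - 2 * r * s * t = 1 - r\<^sup>2"
      unfolding inscribed_family_def by blast
    then have "z = c + t *\<^sub>R f + s *\<^sub>R e" "t\<^sup>2 + s\<^sup>2 - 2 * r * t * s = 1 - r\<^sup>2"
      by (simp_all add: algebra_simps)
    then show "z \<in> inscribed_family c f e r"
      unfolding inscribed_family_def by blast
  qed
  then show ?thesis
    by blast
qed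

lemma inscribed_family_minus: "inscribed_family c (- e) (- f) r = inscribed_family c e f r"
proof -
  have *: "inscribed_family c e f r \<subseteq> inscribed_family c (- e) (- f) r" for e f
  proof
    fix z assume "z \<in> inscribed_family c e f r"
    then obtain s t where "z = c + s *\<^sub>R e + t *\<^sub>R f" "s\<^sup>2 + t\<^sup>2 - 2 * r * s * t = 1 - r\<^sup>2"
      unfolding inscribed_family_def by blast
    then have "z = c + (- s) *\<^sub>R (- e) + (- t) *\<^sub>R (- f)"
      "(- s)\<^sup>2 + (- t)\<^sup>2 - 2 * r * (- s) * (- t) = 1 - r\<^sup>2"
      by simp_all
    then show "z \<in> inscribed_family c (- e) (- f) r"
      unfolding inscribed_family_def by blast
  qed
  show ?thesis
    using *[of e f] *[of "- e" "- f"] by simp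
qed

text \<open>Along the ellipse, the two coordinates are linear functionals on the unit circle with
  unit coefficient vectors \<open>(ms, ns)\<close> and \<open>(mt, nt)\<close>. Their inner product
  is \<open>r\<close> and their determinant squares to \<open>1 - r^2\<close>; eliminating the
  circle parameter gives the equation of the family.\<close>

lemma conjugate_ellipse_eq_inscribed_family:
  fixes ms mt ns nt r :: real
  assumes s: "ms\<^sup>2 + ns\<^sup>2 = 1" and t: "mt\<^sup>2 + nt\<^sup>2 = 1"
    and r: "r = ms * mt + ns * nt" and "ms * nt - ns * mt \<noteq> 0"
  shows "conjugate_ellipse c (ms *\<^sub>R e + mt *\<^sub>R f) (ns *\<^sub>R e + nt *\<^sub>R f) = inscribed_family c e f r"
    (is "?L = ?R")
proof
  define d where "d = ms * nt - ns * mt"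
  have d: "d\<^sup>2 = 1 - r\<^sup>2" "d \<noteq> 0"
    using assms unfolding d_def by (algebra, simp)
  show "?L \<subseteq> ?R"
  proof
    fix z assume "z \<in> ?L"
    then obtain x y where "z = c + x *\<^sub>R (ms *\<^sub>R e + mt *\<^sub>R f) + y *\<^sub>R (ns *\<^sub>R e + nt *\<^sub>R f)"
      and xy: "x\<^sup>2 + y\<^sup>2 = 1"
      unfolding conjugate_ellipse_def by blast
    then have "z = c + (ms * x + ns * y) *\<^sub>R e + (mt * x + nt * y) *\<^sub>R f"
      by (simp add: algebra_simps)
    moreover have "(ms * x + ns * y)\<^sup>2 + (mt * x + nt * y)\<^sup>2
        - 2 * r * (ms * x + ns * y) * (mt * x + nt * y) = 1 - r\<^sup>2"
      using s t xy unfolding r by algebra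
    ultimately show "z \<in> ?R"
      unfolding inscribed_family_def by blast
  qed
  show "?R \<subseteq> ?L"
  proof
    fix z assume "z \<in> ?R"
    then obtain \<sigma> \<tau> where z: "z = c + \<sigma> *\<^sub>R e + \<tau> *\<^sub>R f"
      and st: "\<sigma>\<^sup>2 + \<tau>\<^sup>2 - 2 * r * \<sigma> * \<tau> = 1 - r\<^sup>2"
      unfolding inscribed_family_def by blast
    \<comment> \<open>Cramer's rule for \<open>x * ms + y * ns = \<sigma>\<close> and
      \<open>x * mt + y * nt = \<tau>\<close>.\<close>
    define x where "x = (\<sigma> * nt - \<tau> * ns) / d"
    define y where "y = (\<tau> * ms - \<sigma> * mt) / d"
    have dx: "d * x = \<sigma> * nt - \<tau> * ns" "d * y = \<tau> * ms - \<sigma> * mt"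
      using d by (simp_all add: x_def y_def)
    have "d * (x * ms + y * ns) = d * \<sigma>" "d * (x * mt + y * nt) = d * \<tau>"
      using dx unfolding d_def by algebra+
    then have "\<sigma> = x * ms + y * ns" "\<tau> = x * mt + y * nt"
      using d by simp_all
    then have "z = c + x *\<^sub>R (ms *\<^sub>R e + mt *\<^sub>R f) + y *\<^sub>R (ns *\<^sub>R e + nt *\<^sub>R f)"
      unfolding z by (simp add: algebra_simps)
    moreover have "d\<^sup>2 * (x\<^sup>2 + y\<^sup>2) = d\<^sup>2 * 1"
    proof -
      have "d\<^sup>2 * (x\<^sup>2 + y\<^sup>2) = (\<sigma> * nt - \<tau> * ns)\<^sup>2 + (\<tau> * ms - \<sigma> * mt)\<^sup>2"
        unfolding dx[symmetric] by algebra
      also have "\<dots> = \<sigma>\<^sup>2 + \<tau>\<^sup>2 - 2 * r * \<sigma> * \<tau>"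
        using s t unfolding r by algebra
      finally show ?thesis
        using st d by simp
    qed
    then have "x\<^sup>2 + y\<^sup>2 = 1"
      using d(2) by (metis mult_left_cancel power_not_zero)
    ultimately show "z \<in> ?L"
      unfolding conjugate_ellipse_def by blast
  qed
qed

lemma inscribed_family_semiaxes:
  assumes "cross2 e f \<noteq> 0" "r\<^sup>2 < 1"
  obtains a b where "ellipse_semiaxes (inscribed_family c e f r) a b"
    "(a * b / (a\<^sup>2 + b\<^sup>2))\<^sup>2
      = (1 - r\<^sup>2) * (cross2 e f)\<^sup>2 / (e \<bullet> e + f \<bullet> f + 2 * r * (e \<bullet> f))\<^sup>2"
proof -
  define k where "k = sqrt (1 - r\<^sup>2)"
  have k: "k\<^sup>2 = 1 - r\<^sup>2" "k \<noteq> 0"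
    using assms by (simp_all add: k_def)
  \<comment> \<open>The coefficient vectors are \<open>(1, 0)\<close> and \<open>(r, k)\<close>,
    unit vectors with inner product \<open>r\<close>; \<open>m\<close> leads from the centre to the
    contact point on the side \<open>s = 1\<close>.\<close>
  define m where "m = e + r *\<^sub>R f"
  define n where "n = k *\<^sub>R f"
  have E: "inscribed_family c e f r = conjugate_ellipse c m n"
    using conjugate_ellipse_eq_inscribed_family[of 1 0 r k r c e f] k
    by (simp add: m_def n_def)
  have cross: "cross2 m n = k * cross2 e f"
    by (simp add: m_def n_def)
  then have "cross2 m n \<noteq> 0"
    using k assms by simp
  then obtain a b where ab: "ellipse_semiaxes (inscribed_family c e f r) a b"
    "a\<^sup>2 + b\<^sup>2 = m \<bullet> m + n \<bullet> n" "a * b = \<bar>cross2 m n\<bar>"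
    unfolding E by (rule conjugate_ellipse_semiaxes)
  have "m \<bullet> m + n \<bullet> n = e \<bullet> e + 2 * r * (e \<bullet> f) + (r\<^sup>2 + k\<^sup>2) * (f \<bullet> f)"
    unfolding m_def n_def
    by (simp add: inner_add_left inner_add_right inner_commute algebra_simps power2_eq_square)
  then have "a\<^sup>2 + b\<^sup>2 = e \<bullet> e + f \<bullet> f + 2 * r * (e \<bullet> f)"
    using k ab by simp
  then have "(a * b / (a\<^sup>2 + b\<^sup>2))\<^sup>2
      = (1 - r\<^sup>2) * (cross2 e f)\<^sup>2 / (e \<bullet> e + f \<bullet> f + 2 * r * (e \<bullet> f))\<^sup>2"
    unfolding ab(3) cross by (simp add: power_divide power_mult_distrib k)
  with ab(1) show thesis
    by (rule that)
qed

section \<open>Members of the family are inscribed\<close>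

text \<open>The right side is a translated linear image of a square, hence convex. Conversely,
  interpolation along \<open>e\<close> on the sides \<open>t = -1\<close> and \<open>t = 1\<close>,
  and then along \<open>f\<close> between the results, reaches each of its points.\<close>

lemma convex_hull_parallelogram:
  fixes e f :: "real^2"
  shows "convex hull {c - e - f, c + e - f, c + e + f, c - e + f}
    = {c + s *\<^sub>R e + t *\<^sub>R f | s t. \<bar>s\<bar> \<le> 1 \<and> \<bar>t\<bar> \<le> 1}" (is "convex hull ?V = ?R")
proof
  have "?R = (\<lambda>z. c + (fst z *\<^sub>R e + snd z *\<^sub>R f)) ` ({-1..1} \<times> {-1..1})"
  proof (intro subset_antisym subsetI)
    fix z assume "z \<in> ?R"
    then obtain s t where z: "z = c + s *\<^sub>R e + t *\<^sub>R f" and st: "\<bar>s\<bar> \<le> 1" "\<bar>t\<bar> \<le> 1"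
      by blast
    show "z \<in> (\<lambda>z. c + (fst z *\<^sub>R e + snd z *\<^sub>R f)) ` ({-1..1} \<times> {-1..1})"
      by (rule image_eqI[of _ _ "(s, t)"]) (use st in \<open>auto simp: z abs_le_iff\<close>)
  next
    fix z assume "z \<in> (\<lambda>z. c + (fst z *\<^sub>R e + snd z *\<^sub>R f)) ` ({-1..1} \<times> {-1..1})"
    then obtain s t where "z = c + s *\<^sub>R e + t *\<^sub>R f" "s \<in> {-1..1}" "t \<in> {-1..1}"
      by (auto simp: add.assoc)
    then show "z \<in> ?R"
      by (auto simp: abs_le_iff)
  qed
  also have "\<dots> = (+) c ` (\<lambda>z. fst z *\<^sub>R e + snd z *\<^sub>R f) ` ({-1..1} \<times> {-1..1})"
    by (simp add: image_image)
  finally have R: "?R = (+) c ` (\<lambda>z. fst z *\<^sub>R e + snd z *\<^sub>R f) ` ({-1..1} \<times> {-1..1})" .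
  have "linear (\<lambda>z :: real \<times> real. fst z *\<^sub>R e + snd z *\<^sub>R f)"
    by (rule linearI) (simp_all add: algebra_simps)
  then have "convex ?R"
    unfolding R by (intro convex_translation convex_linear_image convex_Times) auto
  moreover have "?V \<subseteq> ?R"
  proof -
    have "c + s *\<^sub>R e + t *\<^sub>R f \<in> ?R" if "\<bar>s\<bar> \<le> 1" "\<bar>t\<bar> \<le> 1" for s t :: real
      using that by blast
    from this[of "-1" "-1"] this[of 1 "-1"] this[of 1 1] this[of "-1" 1] show ?thesis
      by simp
  qed
  ultimately show "convex hull ?V \<subseteq> ?R"
    by (rule hull_minimal[rotated])
  show "?R \<subseteq> convex hull ?V"
  proof
    fix z assume "z \<in> ?R"
    then obtain s t where z: "z = c + s *\<^sub>R e + t *\<^sub>R f" "\<bar>s\<bar> \<le> 1" "\<bar>t\<bar> \<le> 1"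
      by blast
    have comb: "((1 - h) / 2) *\<^sub>R x + ((1 + h) / 2) *\<^sub>R y \<in> convex hull ?V"
      if "x \<in> convex hull ?V" "y \<in> convex hull ?V" "\<bar>h\<bar> \<le> 1" for x y and h :: real
      by (rule convexD[OF convex_convex_hull]) (use that in \<open>auto simp: field_simps abs_le_iff\<close>)
    have mid: "((1 - h) / 2) *\<^sub>R (w - g) + ((1 + h) / 2) *\<^sub>R (w + g) = w + h *\<^sub>R g"
      for h :: real and w g :: "real^2"
      by (simp add: vec_eq_iff field_simps)
    have "c + s *\<^sub>R e + h *\<^sub>R f \<in> convex hull ?V" if "h = 1 \<or> h = -1" for h :: real
    proof -
      have "(c + h *\<^sub>R f) - e \<in> convex hull ?V" "(c + h *\<^sub>R f) + e \<in> convex hull ?V"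
        using that by (auto intro!: hull_inc simp: algebra_simps)
      from comb[OF this z(2)] show ?thesis
        unfolding mid by (simp add: algebra_simps)
    qed
    from this[of "-1"] this[of 1]
    have "(c + s *\<^sub>R e) - f \<in> convex hull ?V" "(c + s *\<^sub>R e) + f \<in> convex hull ?V"
      by simp_all
    from comb[OF this z(3)] show "z \<in> convex hull ?V"
      unfolding mid z(1) .
  qed
qed

lemma tangent_to_segment_commute: "tangent_to_segment E P Q \<longleftrightarrow> tangent_to_segment E Q P"
  unfolding tangent_to_segment_def by (simp add: closed_segment_commute insert_commute)

text \<open>The contact point has coordinates \<open>(r, 1)\<close>. There \<open>t\<close> is
  maximal along the ellipse, so the velocity is parallel to \<open>e\<close>.\<close>

lemma inscribed_family_tangent:
  assumes r: "r\<^sup>2 < 1" and e: "e \<noteq> 0"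
  shows "tangent_to_segment (inscribed_family c e f r) (c + f - e) (c + f + e)"
proof -
  define k where "k = sqrt (1 - r\<^sup>2)"
  have k: "k\<^sup>2 = 1 - r\<^sup>2" "k \<noteq> 0"
    using r by (simp_all add: k_def)
  \<comment> \<open>For \<open>t = cos \<theta>\<close> the defining equation is quadratic in
    \<open>s\<close>; this path follows one of its roots.\<close>
  define \<gamma> where "\<gamma> \<theta> = c + (r * cos \<theta> - k * sin \<theta>) *\<^sub>R e + cos \<theta> *\<^sub>R f" for \<theta>
  define p where "p = c + r *\<^sub>R e + f"
  have inE: "range \<gamma> \<subseteq> inscribed_family c e f r"
  proof -
    have "(r * cos \<theta> - k * sin \<theta>)\<^sup>2 + (cos \<theta>)\<^sup>2 - 2 * r * (r * cos \<theta> - k * sin \<theta>) * cos \<theta> = 1 - r\<^sup>2"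
      for \<theta>
      using k(1) sin_cos_squared_add[of \<theta>] by algebra
    then show ?thesis
      unfolding \<gamma>_def inscribed_family_def by blast
  qed
  have p: "\<gamma> 0 = p"
    by (simp add: \<gamma>_def p_def)
  have "(\<gamma> has_vector_derivative (- k) *\<^sub>R e) (at 0)"
    unfolding \<gamma>_def by (auto intro!: derivative_eq_intros simp: has_real_derivative_iff_has_vector_derivative[symmetric])
  moreover have "affine hull {c + f - e, c + f + e} = {p + t *\<^sub>R (- k) *\<^sub>R e | t. True}"
  proof -
    have "affine hull {c + f - e, c + f + e} = {c + f - e + u *\<^sub>R (2 *\<^sub>R e) | u. True}"
      unfolding affine_hull_2_alt by (auto simp: algebra_simps scaleR_2)
    also have "\<dots> = {p + t *\<^sub>R (- k) *\<^sub>R e | t. True}"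
    proof (intro subset_antisym subsetI)
      fix z assume "z \<in> {c + f - e + u *\<^sub>R (2 *\<^sub>R e) | u. True}"
      then obtain u where "z = c + f - e + u *\<^sub>R (2 *\<^sub>R e)"
        by blast
      then have "z = p + (2 * u - 1 - r) *\<^sub>R e"
        by (simp add: p_def algebra_simps)
      moreover have "2 * u - 1 - r = ((1 + r - 2 * u) / k) * (- k)"
        using k by simp
      ultimately have "z = p + ((1 + r - 2 * u) / k) *\<^sub>R (- k) *\<^sub>R e"
        by (simp only: scaleR_scaleR)
      then show "z \<in> {p + t *\<^sub>R (- k) *\<^sub>R e | t. True}"
        by blast
    next
      fix z assume "z \<in> {p + t *\<^sub>R (- k) *\<^sub>R e | t. True}"
      then obtain t where "z = p + t *\<^sub>R (- k) *\<^sub>R e"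
        by blast
      then have "z = c + f - e + (1 + r - t * k) *\<^sub>R e"
        by (simp add: p_def algebra_simps)
      then have "z = c + f - e + ((1 + r - t * k) / 2) *\<^sub>R (2 *\<^sub>R e)"
        by simp
      then show "z \<in> {c + f - e + u *\<^sub>R (2 *\<^sub>R e) | u. True}"
        by blast
    qed
    finally show ?thesis .
  qed
  ultimately have tangent: "tangent_line_at (inscribed_family c e f r) p (affine hull {c + f - e, c + f + e})"
    unfolding tangent_line_at_def using inE p k(2) e
    by (intro exI[of _ \<gamma>] exI[of _ "(- k) *\<^sub>R e"]) simp
  have "\<bar>r\<bar> \<le> 1"
    using r abs_square_less_1[of r] by simp
  \<comment> \<open>The coordinate \<open>s\<close> runs from \<open>-1\<close> to \<open>1\<close>
    along the side, so \<open>s = r\<close> has weight \<open>(1 + r) / 2\<close>.\<close>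
  moreover have "p = (1 - (1 + r) / 2) *\<^sub>R (c + f - e) + ((1 + r) / 2) *\<^sub>R (c + f + e)"
    by (simp add: p_def vec_eq_iff field_simps)
  ultimately have "p \<in> closed_segment (c + f - e) (c + f + e)"
    unfolding closed_segment_def by (auto simp: abs_le_iff intro!: exI[of _ "(1 + r) / 2"])
  moreover have "p \<in> inscribed_family c e f r"
    using inE p by auto
  ultimately show ?thesis
    unfolding tangent_to_segment_def using tangent by blast
qed

lemma inscribed_family_inscribed:
  assumes indep: "cross2 e f \<noteq> 0" and r: "r\<^sup>2 < 1"
  shows "inscribed (inscribed_family c e f r) (c - e - f) (c + e - f) (c + e + f) (c - e + f)"
    (is "inscribed ?E _ _ _ _")
proof -
  have nz: "e \<noteq> 0" "f \<noteq> 0"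
    using indep by (auto simp: cross2_def)
  have "is_ellipse ?E"
    using inscribed_family_semiaxes[OF indep r] unfolding is_ellipse_def by metis
  moreover have "?E \<subseteq> convex hull {c - e - f, c + e - f, c + e + f, c - e + f}"
  proof -
    have "\<bar>s\<bar> \<le> 1 \<and> \<bar>t\<bar> \<le> 1" if "s\<^sup>2 + t\<^sup>2 - 2 * r * s * t = 1 - r\<^sup>2" for s t
    proof -
      \<comment> \<open>Completing the square in either variable; since \<open>1 - r^2\<close> is
        positive, both coordinates are bounded by 1.\<close>
      have "(t - r * s)\<^sup>2 = (1 - r\<^sup>2) * (1 - s\<^sup>2)" "(s - r * t)\<^sup>2 = (1 - r\<^sup>2) * (1 - t\<^sup>2)"
        using that by algebra+
      then have "0 \<le> (1 - r\<^sup>2) * (1 - s\<^sup>2)" "0 \<le> (1 - r\<^sup>2) * (1 - t\<^sup>2)"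
        by (metis zero_le_power2)+
      then have "s\<^sup>2 \<le> 1" "t\<^sup>2 \<le> 1"
        using r by (simp_all add: zero_le_mult_iff)
      then show ?thesis
        by (simp add: abs_square_le_1)
    qed
    then show ?thesis
      unfolding convex_hull_parallelogram inscribed_family_def by blast
  qed
  \<comment> \<open>Negating both \<open>e\<close> and \<open>f\<close> passes to the opposite side
    with its endpoints reversed; swapping them passes to an adjacent side.\<close>
  moreover have "tangent_to_segment ?E (c - e - f) (c + e - f)"
    using inscribed_family_tangent[OF r, of "- e" c "- f"] nz
    by (simp add: inscribed_family_minus tangent_to_segment_commute algebra_simps)
  moreover have "tangent_to_segment ?E (c + e - f) (c + e + f)"
    using inscribed_family_tangent[OF r, of f c e] nz
    by (simp add: inscribed_family_swap)
  moreover have "tangent_to_segment ?E (c + e + f) (c - e + f)"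
    using inscribed_family_tangent[OF r, of e c f] nz
    by (simp add: tangent_to_segment_commute algebra_simps)
  moreover have "tangent_to_segment ?E (c - e + f) (c - e - f)"
    using inscribed_family_tangent[OF r, of "- f" c "- e"] nz
    by (simp add: inscribed_family_swap inscribed_family_minus)
  ultimately show ?thesis
    unfolding inscribed_def by blast
qed

section \<open>Every inscribed ellipse belongs to the family\<close>

text \<open>On the unit circle the functional ranges over the interval from \<open>g - R\<close> to
  \<open>g + R\<close>, where \<open>R\<close> is the length of \<open>(m, n)\<close>. The
  hypotheses force this interval to be that from \<open>-1\<close> to \<open>1\<close>.\<close>

lemma circle_functional_range:
  fixes g m n :: real
  assumes bound: "\<And>x y. x\<^sup>2 + y\<^sup>2 = 1 \<Longrightarrow> \<bar>g + x * m + y * n\<bar> \<le> 1"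
    and max: "x1\<^sup>2 + y1\<^sup>2 = 1" "g + x1 * m + y1 * n = 1"
    and min: "x2\<^sup>2 + y2\<^sup>2 = 1" "g + x2 * m + y2 * n = -1"
  shows "g = 0" "m\<^sup>2 + n\<^sup>2 = 1"
proof -
  define R where "R = sqrt (m\<^sup>2 + n\<^sup>2)"
  have R2: "R\<^sup>2 = m\<^sup>2 + n\<^sup>2" and "0 \<le> R"
    by (simp_all add: R_def)
  have cs: "\<bar>x * m + y * n\<bar> \<le> R" if "x\<^sup>2 + y\<^sup>2 = 1" for x y
  proof -
    have "R\<^sup>2 = (x * m + y * n)\<^sup>2 + (x * n - y * m)\<^sup>2"
      using that R2 by algebra
    then have "(x * m + y * n)\<^sup>2 \<le> R\<^sup>2"
      by simp
    then have "\<bar>x * m + y * n\<bar> \<le> \<bar>R\<bar>"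
      by (simp only: abs_le_square_iff)
    then show ?thesis
      using \<open>0 \<le> R\<close> by simp
  qed
  have "g + R \<ge> 1" "g - R \<le> -1"
    using cs[OF max(1)] cs[OF min(1)] max(2) min(2) by linarith+
  then have "R > 0"
    by linarith
  \<comment> \<open>The unit vectors along \<open>(m, n)\<close> and opposite to it are where the
    functional takes its extreme values.\<close>
  have unit: "(m / R)\<^sup>2 + (n / R)\<^sup>2 = 1" "(- (m / R))\<^sup>2 + (- (n / R))\<^sup>2 = 1"
  proof -
    have "(m / R)\<^sup>2 + (n / R)\<^sup>2 = R\<^sup>2 / R\<^sup>2"
      by (simp add: power_divide R2 flip: add_divide_distrib)
    then show "(m / R)\<^sup>2 + (n / R)\<^sup>2 = 1"
      using \<open>R > 0\<close> by simp
    then show "(- (m / R))\<^sup>2 + (- (n / R))\<^sup>2 = 1"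
      by simp
  qed
  have val: "(m / R) * m + (n / R) * n = R"
    using R2 \<open>R > 0\<close> by (simp add: field_simps power2_eq_square)
  have "g + R \<le> 1" "g - R \<ge> -1"
    using bound[OF unit(1)] bound[OF unit(2)] val by (simp_all add: abs_le_iff)
  with \<open>g + R \<ge> 1\<close> \<open>g - R \<le> -1\<close> have "g = 0" "R = 1"
    by linarith+
  then show "g = 0" "m\<^sup>2 + n\<^sup>2 = 1"
    using R2 by simp_all
qed

text \<open>Both coordinates are affine functionals of the circle parameter. Containment bounds them
  by 1 in absolute value, and the contact points on opposite sides attain \<open>-1\<close> and
  \<open>1\<close>, so \<open>circle_functional_range\<close> applies to each.\<close>

lemma inscribed_in_family:
  assumes indep: "cross2 e f \<noteq> 0"
    and ins: "inscribed E (c - e - f) (c + e - f) (c + e + f) (c - e + f)"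
  obtains r where "r\<^sup>2 < 1" "E = inscribed_family c e f r"
proof -
  \<comment> \<open>The coordinates of \<open>z\<close> relative to the centre \<open>c\<close> and
    the basis \<open>e\<close>, \<open>f\<close>.\<close>
  define S where "S z = cross2 (z - c) f / cross2 e f" for z
  define T where "T z = cross2 e (z - c) / cross2 e f" for z
  have ST: "S (c + s *\<^sub>R e + t *\<^sub>R f) = s" "T (c + s *\<^sub>R e + t *\<^sub>R f) = t" for s t
    using indep by (simp_all add: S_def T_def)
  have seg: "\<exists>p\<in>E. p \<in> closed_segment P Q" if "tangent_to_segment E P Q" for P Q
    using that unfolding tangent_to_segment_def by blast
  have bound: "\<bar>S z\<bar> \<le> 1" "\<bar>T z\<bar> \<le> 1" if "z \<in> E" for z
    using ins that unfolding inscribed_def convex_hull_parallelogram by (auto simp: ST)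
  \<comment> \<open>An affine coordinate with equal values at both endpoints of a segment is
    constant along it.\<close>
  have Sseg: "S p = h" if pq: "p \<in> closed_segment P Q" "S P = h" "S Q = h" for p P Q h
  proof -
    obtain u where p: "p = (1 - u) *\<^sub>R P + u *\<^sub>R Q"
      using pq(1) unfolding closed_segment_def by blast
    have "S p = (1 - u) * S P + u * S Q"
      unfolding S_def p using indep by (simp add: field_simps)
    then show ?thesis
      using pq by (simp add: algebra_simps)
  qed
  have Tseg: "T p = h" if pq: "p \<in> closed_segment P Q" "T P = h" "T Q = h" for p P Q h
  proof -
    obtain u where p: "p = (1 - u) *\<^sub>R P + u *\<^sub>R Q"
      using pq(1) unfolding closed_segment_def by blast
    have "T p = (1 - u) * T P + u * T Q"
      unfolding T_def p using indep by (simp add: field_simps)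
    then show ?thesis
      using pq by (simp add: algebra_simps)
  qed
  have vertex: "S (c - e - f) = -1" "S (c + e - f) = 1" "S (c + e + f) = 1" "S (c - e + f) = -1"
    "T (c - e - f) = -1" "T (c + e - f) = -1" "T (c + e + f) = 1" "T (c - e + f) = 1"
    using indep by (simp_all add: S_def T_def field_simps)
  obtain p1 where p1: "p1 \<in> E" "T p1 = -1"
    using seg[of "c - e - f" "c + e - f"] ins Tseg vertex unfolding inscribed_def by metis
  obtain p2 where p2: "p2 \<in> E" "S p2 = 1"
    using seg[of "c + e - f" "c + e + f"] ins Sseg vertex unfolding inscribed_def by metis
  obtain p3 where p3: "p3 \<in> E" "T p3 = 1"
    using seg[of "c + e + f" "c - e + f"] ins Tseg vertex unfolding inscribed_def by metis
  obtain p4 where p4: "p4 \<in> E" "S p4 = -1"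
    using seg[of "c - e + f" "c - e - f"] ins Sseg vertex unfolding inscribed_def by metis
  obtain a b g u v where ab: "0 < b" "b \<le> a" "norm u = 1" "norm v = 1" "orthogonal u v"
    and E0: "E = {g + x *\<^sub>R u + y *\<^sub>R v | x y. x\<^sup>2 / a\<^sup>2 + y\<^sup>2 / b\<^sup>2 = 1}"
    using ins unfolding inscribed_def is_ellipse_def ellipse_semiaxes_def by blast
  define m where "m = a *\<^sub>R u"
  define n where "n = b *\<^sub>R v"
  have E: "E = conjugate_ellipse g m n"
    unfolding E0 m_def n_def by (rule conjugate_ellipse_scaled_axes) (use ab in auto)
  have cross: "cross2 m n \<noteq> 0"
  proof -
    have "(cross2 u v)\<^sup>2 = 1"
      using lagrange_identity2[of u v] ab(3-5) by (simp add: norm_eq_1 orthogonal_def)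
    then show ?thesis
      using ab by (auto simp: m_def n_def)
  qed
  define ms where "ms = cross2 m f / cross2 e f"
  define mt where "mt = cross2 e m / cross2 e f"
  define ns where "ns = cross2 n f / cross2 e f"
  define nt where "nt = cross2 e n / cross2 e f"
  have m: "m = ms *\<^sub>R e + mt *\<^sub>R f" and n: "n = ns *\<^sub>R e + nt *\<^sub>R f"
    unfolding ms_def mt_def ns_def nt_def by (rule cross2_expansion[OF indep])+
  have Sval: "S (g + x *\<^sub>R m + y *\<^sub>R n) = S g + x * ms + y * ns" for x y
    unfolding S_def ms_def ns_def using indep by (simp add: field_simps)
  have Tval: "T (g + x *\<^sub>R m + y *\<^sub>R n) = T g + x * mt + y * nt" for x y
    unfolding T_def mt_def nt_def using indep by (simp add: field_simps)
  have param: "\<exists>x y. x\<^sup>2 + y\<^sup>2 = 1 \<and> S p = S g + x * ms + y * ns \<and> T p = T g + x * mt + y * nt"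
    if "p \<in> E" for p
    using that Sval Tval unfolding E conjugate_ellipse_def by blast
  have on_E: "g + x *\<^sub>R m + y *\<^sub>R n \<in> E" if "x\<^sup>2 + y\<^sup>2 = 1" for x y
    using that unfolding E conjugate_ellipse_def by blast
  have "S g = 0 \<and> ms\<^sup>2 + ns\<^sup>2 = 1"
  proof -
    obtain x1 y1 where 1: "x1\<^sup>2 + y1\<^sup>2 = 1" "S g + x1 * ms + y1 * ns = 1"
      using param[OF p2(1)] p2(2) by auto
    obtain x2 y2 where 2: "x2\<^sup>2 + y2\<^sup>2 = 1" "S g + x2 * ms + y2 * ns = -1"
      using param[OF p4(1)] p4(2) by auto
    have "\<bar>S g + x * ms + y * ns\<bar> \<le> 1" if "x\<^sup>2 + y\<^sup>2 = 1" for x y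
      using bound(1)[OF on_E[OF that]] Sval by simp
    from circle_functional_range[OF this 1 2] show ?thesis
      by blast
  qed
  moreover have "T g = 0 \<and> mt\<^sup>2 + nt\<^sup>2 = 1"
  proof -
    obtain x1 y1 where 1: "x1\<^sup>2 + y1\<^sup>2 = 1" "T g + x1 * mt + y1 * nt = 1"
      using param[OF p3(1)] p3(2) by auto
    obtain x2 y2 where 2: "x2\<^sup>2 + y2\<^sup>2 = 1" "T g + x2 * mt + y2 * nt = -1"
      using param[OF p1(1)] p1(2) by auto
    have "\<bar>T g + x * mt + y * nt\<bar> \<le> 1" if "x\<^sup>2 + y\<^sup>2 = 1" for x y
      using bound(2)[OF on_E[OF that]] Tval by simp
    from circle_functional_range[OF this 1 2] show ?thesis
      by blast
  qed
  ultimately have g0: "S g = 0" "T g = 0" and s: "ms\<^sup>2 + ns\<^sup>2 = 1" and t: "mt\<^sup>2 + nt\<^sup>2 = 1"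
    by blast+
  have "g - c = S g *\<^sub>R e + T g *\<^sub>R f"
    unfolding S_def T_def by (rule cross2_expansion[OF indep])
  then have g: "g = c"
    using g0 by simp
  \<comment> \<open>The cross product of the radii is this determinant times
    \<open>cross2 e f\<close>, and it is nonzero for an ellipse.\<close>
  have d: "ms * nt - ns * mt \<noteq> 0"
  proof
    assume "ms * nt - ns * mt = 0"
    moreover have "cross2 m n = (ms * nt - ns * mt) * cross2 e f"
      unfolding m n using cross2_commute[of f e] by (simp add: algebra_simps)
    ultimately show False
      using cross by simp
  qed
  define r where "r = ms * mt + ns * nt"
  \<comment> \<open>The Lagrange identity for the unit vectors \<open>(ms, ns)\<close> and
    \<open>(mt, nt)\<close>.\<close>
  have "r\<^sup>2 + (ms * nt - ns * mt)\<^sup>2 = 1"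
    using s t unfolding r_def by algebra
  moreover have "0 < (ms * nt - ns * mt)\<^sup>2"
    using d by simp
  ultimately have "r\<^sup>2 < 1"
    by linarith
  moreover have "E = inscribed_family c e f r"
    unfolding E g m n by (rule conjugate_ellipse_eq_inscribed_family[OF s t r_def d])
  ultimately show thesis
    by (rule that)
qed

section \<open>Minimising the eccentricity\<close>

text \<open>The centre is the midpoint of a diagonal, and \<open>e\<close>, \<open>f\<close> are
  half edge vectors; their dependence would make \<open>A\<close>, \<open>B\<close>,
  \<open>C\<close> collinear.\<close>

lemma parallelogram_center:
  assumes "parallelogram A B C D"
  obtains c e f where "cross2 e f \<noteq> 0"
    "A = c - e - f" "B = c + e - f" "C = c + e + f" "D = c - e + f"
proof -
  define c where "c = (1/2) *\<^sub>R (A + C)"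
  define e where "e = (1/2) *\<^sub>R (B - A)"
  define f where "f = (1/2) *\<^sub>R (C - B)"
  have D: "D = A - B + C"
  proof -
    have "D = C - (C - D)"
      by simp
    also have "C - D = B - A"
      using assms unfolding parallelogram_def by simp
    finally show ?thesis
      by simp
  qed
  have v: "A = c - e - f" "B = c + e - f" "C = c + e + f" "D = c - e + f"
    unfolding D c_def e_def f_def by (simp_all add: vec_eq_iff field_simps)
  have "cross2 e f \<noteq> 0"
  proof
    assume "cross2 e f = 0"
    moreover have "A - B = (- 2) *\<^sub>R e" "C - B = 2 *\<^sub>R f"
      unfolding v by (simp_all add: scaleR_2 algebra_simps)
    ultimately have "cross2 (A - B) (C - B) = 0"
      by simp
    then have "collinear {0, A - B, C - B}"
      by (rule collinear_if_cross2_eq_0)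
    then show False
      using assms collinear_3[of A B C] unfolding parallelogram_def by simp
  qed
  from that[OF this v] show thesis .
qed

text \<open>Once denominators are cleared, both claims follow from the identity \<open>id\<close>,
  whose right side is a square vanishing only at the stated \<open>r\<close>. The assumptions make
  \<open>p + 2 * r * q\<close> and \<open>p^2 - 4 * q^2\<close> positive.\<close>

lemma ratio_bound:
  fixes p q r :: real
  assumes "2 * \<bar>q\<bar> < p" "r\<^sup>2 < 1"
  shows "(1 - r\<^sup>2) / (p + 2 * r * q)\<^sup>2 \<le> 1 / (p\<^sup>2 - 4 * q\<^sup>2)"
    and "(1 - r\<^sup>2) / (p + 2 * r * q)\<^sup>2 = 1 / (p\<^sup>2 - 4 * q\<^sup>2) \<longleftrightarrow> r = - 2 * q / p"
proof -
  have "\<bar>r\<bar> < 1"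
    using assms(2) by (simp add: abs_square_less_1)
  then have "\<bar>r * q\<bar> \<le> \<bar>q\<bar>"
    by (simp add: abs_mult mult_left_le_one_le)
  then have "0 < p + 2 * r * q"
    using assms(1) by linarith
  then have N: "0 < (p + 2 * r * q)\<^sup>2"
    by simp
  have "(2 * \<bar>q\<bar>)\<^sup>2 < p\<^sup>2"
    using assms(1) by (intro power_strict_mono) auto
  then have M: "0 < p\<^sup>2 - 4 * q\<^sup>2"
    by (simp add: power_mult_distrib)
  have id: "(p + 2 * r * q)\<^sup>2 - (1 - r\<^sup>2) * (p\<^sup>2 - 4 * q\<^sup>2) = (r * p + 2 * q)\<^sup>2"
    by algebra
  then have "(1 - r\<^sup>2) * (p\<^sup>2 - 4 * q\<^sup>2) \<le> (p + 2 * r * q)\<^sup>2"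
    by (metis zero_le_power2 diff_ge_0_iff_ge)
  then show "(1 - r\<^sup>2) / (p + 2 * r * q)\<^sup>2 \<le> 1 / (p\<^sup>2 - 4 * q\<^sup>2)"
    using N M by (simp add: divide_simps)
  have "p > 0"
    using assms(1) by linarith
  have "(1 - r\<^sup>2) / (p + 2 * r * q)\<^sup>2 = 1 / (p\<^sup>2 - 4 * q\<^sup>2)
      \<longleftrightarrow> (1 - r\<^sup>2) * (p\<^sup>2 - 4 * q\<^sup>2) = (p + 2 * r * q)\<^sup>2"
    using N M by (simp add: frac_eq_eq)
  also have "\<dots> \<longleftrightarrow> r * p + 2 * q = 0"
    using id by (metis eq_iff_diff_eq_0 power2_eq_iff_nonneg zero_eq_power2)
  also have "\<dots> \<longleftrightarrow> r = - 2 * q / p"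
    using \<open>p > 0\<close> by (auto simp: field_simps)
  finally show "(1 - r\<^sup>2) / (p + 2 * r * q)\<^sup>2 = 1 / (p\<^sup>2 - 4 * q\<^sup>2) \<longleftrightarrow> r = - 2 * q / p" .
qed

theorem proposition2:
  fixes A B C D :: "real^2"
  assumes "parallelogram A B C D"
  shows "\<exists>!E. inscribed E A B C D \<and>
           (\<forall>E'. inscribed E' A B C D \<longrightarrow> eccentricity E \<le> eccentricity E')"
proof -
  obtain c e f where indep: "cross2 e f \<noteq> 0"
    and v: "A = c - e - f" "B = c + e - f" "C = c + e + f" "D = c - e + f"
    using assms by (rule parallelogram_center)
  define F where "F = inscribed_family c e f"
  define p where "p = e \<bullet> e + f \<bullet> f"
  define q where "q = e \<bullet> f"
  \<comment> \<open>The squared ratio of \<open>eccentricity_le_iff\<close>, without the factor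
    \<open>(cross2 e f)^2\<close> common to all \<open>r\<close>.\<close>
  define G where "G r = (1 - r\<^sup>2) / (p + 2 * r * q)\<^sup>2" for r
  define r0 where "r0 = - 2 * q / p"
  \<comment> \<open>\<open>p + 2 * q\<close> and \<open>p - 2 * q\<close> are the squared lengths of
    the half diagonals \<open>e + f\<close> and \<open>e - f\<close>.\<close>
  have pq: "2 * \<bar>q\<bar> < p"
  proof -
    have "e + f \<noteq> 0" "e - f \<noteq> 0"
      using indep by (auto simp: eq_neg_iff_add_eq_0[symmetric])
    then have "0 < (e + f) \<bullet> (e + f)" "0 < (e - f) \<bullet> (e - f)"
      by simp_all
    then show ?thesis
      by (simp add: p_def q_def algebra_simps inner_commute)
  qed
  \<comment> \<open>The optimal parameter is admissible, so the minimum is attained by an actual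
    ellipse.\<close>
  have r0: "r0\<^sup>2 < 1"
  proof -
    have "\<bar>r0\<bar> < 1"
      using pq by (simp add: r0_def abs_mult)
    then show ?thesis
      by (simp add: abs_square_less_1)
  qed
  have ins: "inscribed E A B C D \<longleftrightarrow> (\<exists>r. r\<^sup>2 < 1 \<and> E = F r)" for E
    unfolding v F_def using inscribed_family_inscribed[OF indep] inscribed_in_family[OF indep] by metis
  have ecc: "eccentricity (F r') \<le> eccentricity (F r) \<longleftrightarrow> G r \<le> G r'"
    if r: "r\<^sup>2 < 1" and r': "r'\<^sup>2 < 1" for r r'
  proof -
    obtain a b where ab: "ellipse_semiaxes (F r) a b"
      "(a * b / (a\<^sup>2 + b\<^sup>2))\<^sup>2 = (1 - r\<^sup>2) * (cross2 e f)\<^sup>2 / (p + 2 * r * q)\<^sup>2"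
      unfolding F_def p_def q_def by (rule inscribed_family_semiaxes[OF indep r])
    obtain a' b' where ab': "ellipse_semiaxes (F r') a' b'"
      "(a' * b' / (a'\<^sup>2 + b'\<^sup>2))\<^sup>2 = (1 - r'\<^sup>2) * (cross2 e f)\<^sup>2 / (p + 2 * r' * q)\<^sup>2"
      unfolding F_def p_def q_def by (rule inscribed_family_semiaxes[OF indep r'])
    have "eccentricity (F r') \<le> eccentricity (F r)
        \<longleftrightarrow> G r * (cross2 e f)\<^sup>2 \<le> G r' * (cross2 e f)\<^sup>2"
      unfolding eccentricity_le_iff[OF ab(1) ab'(1)] ab(2) ab'(2) G_def by simp
    also have "\<dots> \<longleftrightarrow> G r \<le> G r'"
      using indep by simp
    finally show ?thesis .
  qed
  \<comment> \<open>\<open>G r0\<close> equals the upper bound of \<open>ratio_bound\<close>, so any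
    \<open>r\<close> reaching it is in the equality case.\<close>
  have max: "G r \<le> G r0" and max_eq: "G r0 \<le> G r \<Longrightarrow> r = r0" if "r\<^sup>2 < 1" for r
    using ratio_bound[OF pq that] ratio_bound(2)[OF pq r0] unfolding G_def r0_def by auto
  show ?thesis
  proof (rule ex1I[of _ "F r0"])
    show "inscribed (F r0) A B C D \<and>
        (\<forall>E'. inscribed E' A B C D \<longrightarrow> eccentricity (F r0) \<le> eccentricity E')"
      using ins r0 ecc max by auto
  next
    fix E
    assume E: "inscribed E A B C D \<and>
        (\<forall>E'. inscribed E' A B C D \<longrightarrow> eccentricity E \<le> eccentricity E')"
    then obtain r where r: "r\<^sup>2 < 1" "E = F r"
      using ins by blast
    have "eccentricity (F r) \<le> eccentricity (F r0)"
      using E ins r0 r(2) by blast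
    then show "E = F r0"
      using ecc[OF r0 r(1)] max_eq[OF r(1)] r(2) by simp
  qed
qed

end
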